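(* Let $(a_k)_{k\ge1}$ and $(b_k)_{k\ge1}$ be sequences of complex numbers such that, for some $p$ with $\Re(p)>1$, $a_k=o(k^{-p})$ and $b_k=o(k^{-p})$. Put $A_n=\sum_{k=1}^n a_k$, $B_n=\sum_{k=1}^n b_k$, $A=\lim A_n$, $B=\lim B_n$. Let $r\ge2$ be an integer. Then \begin{align*} \sum_{k=1}^\infty (A-A_k)(B-B_k)\big(\zeta(r)-\zeta_k(r)\big) ={}&\zeta(r)\Big\{\sum_{n=1}^\infty\Big(\sum_{k=1}^n ka_k\Big)b_n+\sum_{n=1}^\infty\Big(\sum_{k=1}^n kb_k\Big)a_n-\sum_{n=1}^\infty na_nb_n-AB\Big\}\\ &-\sum_{n=1}^\infty\Big(\sum_{k=1}^n a_k\big(k\zeta_k(r)-\zeta_k(r-1)\big)\Big)b_n-\sum_{n=1}^\infty\Big(\sum_{k=1}^n b_k\big(k\zeta_k(r)-\zeta_k(r-1)\big)\Big)a_n\\ &+\sum_{n=1}^\infty a_nb_n\big(n\zeta_n(r)-\zeta_n(r-1)\big). \end{align*}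
   Context: $\zeta(s)=\sum_{j\ge1}j^{-s}$ is the Riemann zeta function and $\zeta_n(s)=\sum_{j=1}^n j^{-s}$ its partial sum (so $\zeta_n(1)=H_n$ is the harmonic number), with $\zeta_0(s)=0$.
   Formalization: The first two right-hand series can diverge (a_k=b_k=k^(-3/2), p=5/4), so the printed identity is proved when both converge (always if Re(p)>3/2); in general the right side is the limit of its terms truncated at a common N. *)

theory Defs
  imports "HOL-Analysis.Analysis" "HOL-Library.Landau_Symbols"
begin

text \<open>
  The Dirichlet series of the zeta function, without analytic continuation: it is
  meaningful only for \<open>Re s > 1\<close>. Its partial sums are defined for every \<open>s\<close>.
\<close>

definition zeta :: "complex \<Rightarrow> complex" where
  "zeta s = (\<Sum>j. of_nat (Suc j) powr (- s))"

definition zeta_partial :: "nat \<Rightarrow> complex \<Rightarrow> complex" where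
  "zeta_partial n s = (\<Sum>j=1..n. of_nat j powr (- s))"

text \<open>
  Sequences \<open>f\<close> are indexed from 1, so that \<open>f 0\<close> plays no role in the notions below.
\<close>

definition partial_sum :: "(nat \<Rightarrow> complex) \<Rightarrow> nat \<Rightarrow> complex" where
  "partial_sum f n = (\<Sum>k=1..n. f k)"

definition series_converges :: "(nat \<Rightarrow> complex) \<Rightarrow> bool" where
  "series_converges f \<longleftrightarrow> summable (\<lambda>k. f (Suc k))"

definition series :: "(nat \<Rightarrow> complex) \<Rightarrow> complex" where
  "series f = (\<Sum>k. f (Suc k))"

end

theory Submission
  imports Defs
begin

text \<open>
  Let \<open>T\<^sub>j = \<zeta>(r) - \<zeta>\<^sub>j(r)\<close>. Interchanging summations gives
  \<open>k \<zeta>(r) - (k \<zeta>\<^sub>k(r) - \<zeta>\<^sub>k(r - 1)) = T\<^sub>0 + \<dots> + T\<^bsub>k-1\<^esub> =: c\<^sub>k\<close>. So the right-hand side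
  truncated at \<open>N\<close> is the sum of \<open>c\<^bsub>min(m,n)\<^esub> a\<^sub>m b\<^sub>n\<close> over the square \<open>m, n \<le> N\<close>, minus
  \<open>\<zeta>(r) A B\<close>, and the square sum equals \<open>\<Sum>j<N. T\<^sub>j (A\<^sub>N - A\<^sub>j) (B\<^sub>N - B\<^sub>j)\<close>.
  As \<open>N\<close> grows, Tannery's theorem applies to this sum, with a dominating sequence built from
  \<open>\<bar>T\<^sub>j\<bar> \<Sum>k>j. \<bar>a\<^sub>k\<bar>\<close>, and its term at \<open>j = 0\<close> cancels \<open>\<zeta>(r) A B\<close> in the limit. The same
  majorant bounds \<open>\<Sum>k. \<bar>a\<^sub>k c\<^sub>k\<bar>\<close>, so the fourth and fifth series differ from \<open>\<zeta>(r)\<close> times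
  the first and second by absolutely convergent ones.
\<close>

section \<open>Tails of absolutely convergent series and their decay\<close>

text \<open>The term at index \<open>k\<close> belongs to the tail. For a convergent series
  reindexed from 0, such as \<open>x k = a (Suc k)\<close>, this makes \<open>tail x j\<close> equal
  to \<open>A - A\<^sub>j\<close>.\<close>

definition tail :: "(nat \<Rightarrow> 'a::real_normed_vector) \<Rightarrow> nat \<Rightarrow> 'a" where
  "tail f k = (\<Sum>i. f (i + k))"

lemma tail_eq: "summable f \<Longrightarrow> tail f k = suminf f - (\<Sum>i<k. f i)"
  by (simp add: tail_def suminf_minus_initial_segment)

lemma norm_tail_le:
  fixes f :: "nat \<Rightarrow> 'a::banach"
  assumes "summable (\<lambda>k. norm (f k))"
  shows "norm (tail f k) \<le> tail (\<lambda>k. norm (f k)) k"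
  unfolding tail_def by (rule summable_norm) (use assms in \<open>simp add: summable_iff_shift[of "\<lambda>k. norm (f k)"]\<close>)

lemma tail_norm_nonneg:
  fixes f :: "nat \<Rightarrow> 'a::banach"
  assumes "summable (\<lambda>k. norm (f k))"
  shows "0 \<le> tail (\<lambda>k. norm (f k)) k"
  using norm_tail_le[OF assms, of k] norm_ge_zero order_trans by blast

lemma tail_norm_le_suminf:
  fixes f :: "nat \<Rightarrow> 'a::banach"
  assumes "summable (\<lambda>k. norm (f k))"
  shows "tail (\<lambda>k. norm (f k)) k \<le> (\<Sum>k. norm (f k))"
  unfolding tail_eq[OF assms] by (simp add: sum_nonneg)

lemma sum_diff_le_tail:
  fixes f :: "nat \<Rightarrow> 'a::banach"
  assumes "summable (\<lambda>k. norm (f k))" "j \<le> N"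
  shows "norm (sum f {..<N} - sum f {..<j}) \<le> tail (\<lambda>k. norm (f k)) j"
proof -
  have "sum f {..<N} - sum f {..<j} = sum f {j..<N}"
    using assms(2) sum_diff_nat_ivl[of 0 j N f] by (simp add: atLeast0LessThan)
  then have "norm (sum f {..<N} - sum f {..<j}) \<le> (\<Sum>k=j..<N. norm (f k))"
    by (simp add: norm_sum)
  also have "\<dots> = (\<Sum>k<N. norm (f k)) - (\<Sum>k<j. norm (f k))"
    using assms(2) sum_diff_nat_ivl[of 0 j N "\<lambda>k. norm (f k)"] by (simp add: atLeast0LessThan)
  also have "\<dots> \<le> tail (\<lambda>k. norm (f k)) j"
    unfolding tail_eq[OF assms(1)] by (simp add: sum_le_suminf[OF assms(1)])
  finally show ?thesis .
qed

lemma summable_norm_of_weighted: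
  fixes f :: "nat \<Rightarrow> 'a::real_normed_vector"
  assumes "0 \<le> s" "summable (\<lambda>k. norm (f k) * real (Suc k) powr s)"
  shows "summable (\<lambda>k. norm (f k))"
proof (rule summable_comparison_test'[OF assms(2)])
  fix k
  show "norm (norm (f k)) \<le> norm (f k) * real (Suc k) powr s"
    using ge_one_powr_ge_zero[of "real (Suc k)" s] assms(1) mult_left_mono[of 1 _ "norm (f k)"]
    by simp
qed

text \<open>Every weight occurring in the tail from \<open>j\<close> on is at least
  \<open>real (Suc j) powr s\<close>. Pulling this factor out leaves a weighted tail, which is at
  most the full weighted sum.\<close>

lemma tail_norm_le_powr:
  fixes f :: "nat \<Rightarrow> 'a::banach"
  assumes s: "0 \<le> s" and f: "summable (\<lambda>k. norm (f k) * real (Suc k) powr s)"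
  shows "tail (\<lambda>k. norm (f k)) j
           \<le> (\<Sum>k. norm (f k) * real (Suc k) powr s) * real (Suc j) powr (- s)"
proof -
  let ?w = "\<lambda>k. norm (f k) * real (Suc k) powr s"
  have f1: "summable (\<lambda>k. norm (f (k + j)))"
    using summable_norm_of_weighted[OF assms] by (simp add: summable_iff_shift[of "\<lambda>k. norm (f k)"])
  have f2: "summable (\<lambda>k. ?w (k + j))"
    using f by (subst summable_iff_shift)
  have "tail (\<lambda>k. norm (f k)) j \<le> (\<Sum>k. ?w (k + j) * real (Suc j) powr (- s))"
    unfolding tail_def
  proof (rule suminf_le[OF _ f1 summable_mult2[OF f2]])
    fix k
    have "1 = real (Suc j) powr s * real (Suc j) powr (- s)"
      by (simp add: powr_minus)
    also have "\<dots> \<le> real (Suc (k + j)) powr s * real (Suc j) powr (- s)"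
      using s by (intro mult_right_mono powr_mono2) auto
    finally show "norm (f (k + j)) \<le> ?w (k + j) * real (Suc j) powr (- s)"
      using mult_left_mono[of 1 _ "norm (f (k + j))"] by (simp add: mult.assoc)
  qed
  also have "\<dots> = (\<Sum>k. ?w (k + j)) * real (Suc j) powr (- s)"
    by (rule suminf_mult2[OF f2, symmetric])
  also have "\<dots> \<le> suminf ?w * real (Suc j) powr (- s)"
    unfolding suminf_minus_initial_segment[OF f] by (intro mult_right_mono) (auto intro!: sum_nonneg)
  finally show ?thesis .
qed

lemma summable_Suc_powr: "s < -1 \<Longrightarrow> summable (\<lambda>k. real (Suc k) powr s)"
  using summable_real_powr_iff[of s] summable_Suc_iff[of "\<lambda>k. real k powr s"] by simp

text \<open>The two tails decay like powers with exponents \<open>- s\<close> and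
  \<open>- t\<close>, whose sum lies below -1. In the application \<open>f\<close> consists of the
  terms of the zeta series and \<open>g\<close> is one of the two given sequences.\<close>

lemma summable_tail_times_tail:
  fixes f :: "nat \<Rightarrow> 'a::banach" and g :: "nat \<Rightarrow> 'b::banach"
  assumes "0 \<le> s" "0 \<le> t" "1 < s + t"
    and f: "summable (\<lambda>k. norm (f k) * real (Suc k) powr s)"
    and g: "summable (\<lambda>k. norm (g k) * real (Suc k) powr t)"
  shows "summable (\<lambda>j. norm (tail f j) * tail (\<lambda>k. norm (g k)) j)"
proof (rule summable_comparison_test'[where N = 0])
  define F where "F = (\<Sum>k. norm (f k) * real (Suc k) powr s)"
  define G where "G = (\<Sum>k. norm (g k) * real (Suc k) powr t)"
  show "summable (\<lambda>j. F * G * real (Suc j) powr (- (s + t)))"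
    using assms(3) by (intro summable_mult summable_Suc_powr) simp
  fix j
  note nf = summable_norm_of_weighted[OF assms(1) f]
  note ng = summable_norm_of_weighted[OF assms(2) g]
  have "norm (tail f j) \<le> F * real (Suc j) powr (- s)"
    unfolding F_def by (rule order_trans[OF norm_tail_le[OF nf] tail_norm_le_powr[OF assms(1) f]])
  moreover have "tail (\<lambda>k. norm (g k)) j \<le> G * real (Suc j) powr (- t)"
    unfolding G_def by (rule tail_norm_le_powr[OF assms(2) g])
  ultimately have "norm (tail f j) * tail (\<lambda>k. norm (g k)) j
      \<le> (F * real (Suc j) powr (- s)) * (G * real (Suc j) powr (- t))"
    using tail_norm_nonneg[OF ng, of j] norm_ge_zero[of "tail f j"] by (intro mult_mono) linarith+
  also have "\<dots> = F * G * real (Suc j) powr (- (s + t))"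
    using powr_add[of "real (Suc j)" "- s" "- t"] by simp
  finally show "norm (norm (tail f j) * tail (\<lambda>k. norm (g k)) j)
      \<le> F * G * real (Suc j) powr (- (s + t))"
    using tail_norm_nonneg[OF ng, of j] by simp
qed

section \<open>Finite summation identities\<close>

text \<open>After swapping the sums, \<open>T j\<close> meets exactly the \<open>x k\<close> with
  \<open>j \<le> k < N\<close>. This evaluates the mixed terms of the two-sequence identity and
  bounds the sums weighted by \<open>c\<close>.\<close>

lemma sum_weighted_by_partial_sums:
  fixes x T :: "nat \<Rightarrow> 'a::comm_ring"
  shows "(\<Sum>k<N. (\<Sum>j\<le>k. T j) * x k) = (\<Sum>j<N. T j * (sum x {..<N} - sum x {..<j}))"
proof (induction N)
  case (Suc N)
  have "(\<Sum>j<Suc N. T j * (sum x {..<Suc N} - sum x {..<j}))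
      = (\<Sum>j\<le>N. T j * (sum x {..<N} - sum x {..<j}) + T j * x N)"
    by (simp add: lessThan_Suc_atMost[symmetric] algebra_simps sum.distrib sum_subtractf)
  also have "\<dots> = (\<Sum>j<N. T j * (sum x {..<N} - sum x {..<j})) + (\<Sum>j\<le>N. T j) * x N"
    by (simp add: sum.distrib flip: lessThan_Suc_atMost sum_distrib_right)
  finally show ?case
    using Suc.IH by simp
qed simp

text \<open>The left side collects \<open>c (min m n) * x m * y n\<close> by the larger index; both
  inner sums contain the diagonal, hence the subtraction. As \<open>T j\<close> occurs in
  \<open>c (min m n)\<close> exactly when both indices are at least \<open>j\<close>, its
  coefficient factors.\<close>

lemma sum_symmetric_by_partial_sums:
  fixes x y T :: "nat \<Rightarrow> 'a::comm_ring"
  defines "c \<equiv> \<lambda>k. \<Sum>j\<le>k. T j"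
  shows "(\<Sum>n<N. (\<Sum>k\<le>n. c k * x k) * y n + (\<Sum>k\<le>n. c k * y k) * x n - c n * x n * y n)
       = (\<Sum>j<N. T j * (sum x {..<N} - sum x {..<j}) * (sum y {..<N} - sum y {..<j}))"
proof (induction N)
  case (Suc N)
  let ?X = "\<lambda>j. sum x {..<N} - sum x {..<j}" and ?Y = "\<lambda>j. sum y {..<N} - sum y {..<j}"
  have "(\<Sum>j<Suc N. T j * (sum x {..<Suc N} - sum x {..<j}) * (sum y {..<Suc N} - sum y {..<j}))
      = (\<Sum>j<Suc N. T j * ?X j * ?Y j + T j * ?X j * y N + T j * ?Y j * x N + T j * x N * y N)"
    by (intro sum.cong refl) (simp add: algebra_simps)
  also have "\<dots> = (\<Sum>j<Suc N. T j * ?X j * ?Y j) + (\<Sum>j<Suc N. T j * ?X j) * y N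
      + (\<Sum>j<Suc N. T j * ?Y j) * x N + (\<Sum>j<Suc N. T j) * x N * y N"
    by (simp only: sum.distrib sum_distrib_right)
  \<comment> \<open>The terms at \<open>j = N\<close> of the first three sums vanish because
    \<open>?X N\<close> and \<open>?Y N\<close> are 0.\<close>
  also have "\<dots> = (\<Sum>j<N. T j * ?X j * ?Y j) + (\<Sum>k<N. c k * x k) * y N
      + (\<Sum>k<N. c k * y k) * x N + c N * x N * y N"
    unfolding c_def sum_weighted_by_partial_sums by (simp flip: lessThan_Suc_atMost)
  finally show ?case
    using Suc.IH by (simp add: algebra_simps flip: lessThan_Suc_atMost)
qed simp

section \<open>Passage to the limit by dominated summation\<close>

context
  fixes x y T c :: "nat \<Rightarrow> complex"
  assumes x: "summable (\<lambda>k. norm (x k))" and y: "summable (\<lambda>k. norm (y k))"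
    and Tx: "summable (\<lambda>j. norm (T j) * tail (\<lambda>k. norm (x k)) j)"
  defines "c \<equiv> \<lambda>k. \<Sum>j\<le>k. T j"
begin

lemma symmetric_sum_tendsto:
  shows "summable (\<lambda>j. T j * tail x j * tail y j)"
    and "(\<lambda>N. \<Sum>n<N. (\<Sum>k\<le>n. c k * x k) * y n + (\<Sum>k\<le>n. c k * y k) * x n - c n * x n * y n)
           \<longlonglongrightarrow> (\<Sum>j. T j * tail x j * tail y j)"
proof -
  let ?D = "\<lambda>j N. T j * (sum x {..<N} - sum x {..<j}) * (sum y {..<N} - sum y {..<j})"
  \<comment> \<open>Extension by 0 turns sums of growing length into series over a fixed index set,
    the form that Tannery's theorem treats.\<close>
  let ?f = "\<lambda>j N. if j < N then ?D j N else 0"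
  \<comment> \<open>The tail of \<open>y\<close> is replaced by its total norm, so that
    \<open>Tx\<close> alone makes the majorant summable.\<close>
  define M where "M = (\<lambda>j. norm (T j) * tail (\<lambda>k. norm (x k)) j * (\<Sum>k. norm (y k)))"
  have "(\<lambda>N. ?f j N) \<longlonglongrightarrow> T j * tail x j * tail y j" for j
  proof (rule Lim_transform_eventually)
    show "(\<lambda>N. ?D j N) \<longlonglongrightarrow> T j * tail x j * tail y j"
      unfolding tail_eq[OF summable_norm_cancel[OF x]] tail_eq[OF summable_norm_cancel[OF y]]
      by (intro tendsto_mult tendsto_diff tendsto_const
          summable_LIMSEQ[OF summable_norm_cancel[OF x]] summable_LIMSEQ[OF summable_norm_cancel[OF y]])
    show "\<forall>\<^sub>F N in sequentially. ?D j N = ?f j N"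
      using eventually_gt_at_top[of j] by eventually_elim simp
  qed
  moreover have "norm (?f j N) \<le> M j" for j N
  proof (cases "j < N")
    case True
    have "norm (?D j N) \<le> norm (T j) * tail (\<lambda>k. norm (x k)) j * tail (\<lambda>k. norm (y k)) j"
      unfolding norm_mult
      using True tail_norm_nonneg[OF x]
      by (intro mult_mono sum_diff_le_tail x y mult_nonneg_nonneg) auto
    also have "\<dots> \<le> M j"
      unfolding M_def by (intro mult_left_mono tail_norm_le_suminf y mult_nonneg_nonneg
          norm_ge_zero tail_norm_nonneg[OF x])
    finally show ?thesis
      using True by simp
  next
    case False
    then show ?thesis
      unfolding M_def by (auto intro!: mult_nonneg_nonneg tail_norm_nonneg[OF x] suminf_nonneg y)
  qed
  moreover have "summable M"
    unfolding M_def by (intro summable_mult2 Tx)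
  ultimately have "summable (\<lambda>j. norm (T j * tail x j * tail y j))"
    and lim: "(\<lambda>N. \<Sum>j. ?f j N) \<longlonglongrightarrow> (\<Sum>j. T j * tail x j * tail y j)"
    using tannerys_theorem[of ?f "\<lambda>j. T j * tail x j * tail y j" sequentially M]
    by (auto simp: always_eventually)
  then show "summable (\<lambda>j. T j * tail x j * tail y j)"
    by (blast intro: summable_norm_cancel)
  have "(\<Sum>j. ?f j N) = (\<Sum>j<N. ?D j N)" for N
    using suminf_finite[of "{..<N}" "\<lambda>j. ?f j N"] by simp
  then show "(\<lambda>N. \<Sum>n<N. (\<Sum>k\<le>n. c k * x k) * y n + (\<Sum>k\<le>n. c k * y k) * x n
                - c n * x n * y n) \<longlonglongrightarrow> (\<Sum>j. T j * tail x j * tail y j)"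
    using lim unfolding c_def sum_symmetric_by_partial_sums by simp
qed

text \<open>The inner sums are bounded by a constant independent of \<open>n\<close>, and
  \<open>y\<close> is absolutely summable.\<close>

lemma summable_weighted_product:
  "summable (\<lambda>n. (\<Sum>k\<le>n. c k * x k) * y n)"
proof (rule summable_comparison_test')
  define K where "K = (\<Sum>j. norm (T j) * tail (\<lambda>k. norm (x k)) j)"
  show "summable (\<lambda>n. K * norm (y n))"
    by (intro summable_mult y)
  fix n
  have "norm (\<Sum>k\<le>n. c k * x k) \<le> K"
  proof -
    have "(\<Sum>k\<le>n. c k * x k)
        = (\<Sum>j<Suc n. T j * (sum x {..<Suc n} - sum x {..<j}))"
      unfolding c_def lessThan_Suc_atMost[of n, symmetric] by (rule sum_weighted_by_partial_sums)
    also have "norm \<dots> \<le> (\<Sum>j<Suc n. norm (T j) * tail (\<lambda>k. norm (x k)) j)"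
    proof (rule sum_norm_le)
      fix j assume "j \<in> {..<Suc n}"
      then show "norm (T j * (sum x {..<Suc n} - sum x {..<j}))
          \<le> norm (T j) * tail (\<lambda>k. norm (x k)) j"
        unfolding norm_mult by (intro mult_left_mono sum_diff_le_tail x) auto
    qed
    also have "\<dots> \<le> K"
      unfolding K_def by (intro sum_le_suminf Tx) (auto intro!: mult_nonneg_nonneg tail_norm_nonneg[OF x])
    finally show ?thesis .
  qed
  then show "norm ((\<Sum>k\<le>n. c k * x k) * y n) \<le> K * norm (y n)"
    unfolding norm_mult by (rule mult_right_mono) simp
qed

end

section \<open>Consequences of the decay hypothesis\<close>

text \<open>An eventual bound extends to all positive indices by enlarging the constant. Index 0 is
  excluded because \<open>0 powr (- Re p)\<close> is 0.\<close>

lemma smallo_powr_bound: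
  fixes f :: "nat \<Rightarrow> complex"
  assumes "f \<in> o(\<lambda>k. of_nat k powr (- p))"
  obtains C where "\<And>k. norm (f (Suc k)) \<le> C * real (Suc k) powr (- Re p)"
proof -
  have norm_powr: "norm (of_nat k powr (- p) :: complex) = real k powr (- Re p)" for k
    by (simp add: norm_powr_real_powr)
  have "eventually (\<lambda>k. norm (f k) \<le> 1 * norm (of_nat k powr (- p) :: complex)) at_top"
    using assms by (rule landau_o.smallD) simp
  then obtain m where m: "\<And>k. k \<ge> m \<Longrightarrow> norm (f k) \<le> real k powr (- Re p)"
    unfolding eventually_at_top_linorder norm_powr by auto
  \<comment> \<open>The 1 serves the indices from \<open>m\<close> on; the sum dominates each of the
    finitely many earlier weighted norms.\<close>
  define C where "C = 1 + (\<Sum>k<m. norm (f k) * real k powr Re p)"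
  have C1: "1 \<le> C"
    unfolding C_def by (simp add: sum_nonneg)
  have "norm (f (Suc k)) \<le> C * real (Suc k) powr (- Re p)" for k
  proof (cases "Suc k < m")
    case True
    then have "norm (f (Suc k)) * real (Suc k) powr Re p \<le> (\<Sum>k<m. norm (f k) * real k powr Re p)"
      by (intro member_le_sum) auto
    then have "norm (f (Suc k)) * real (Suc k) powr Re p \<le> C"
      by (simp add: C_def)
    then have "norm (f (Suc k)) * real (Suc k) powr Re p * real (Suc k) powr (- Re p)
        \<le> C * real (Suc k) powr (- Re p)"
      by (rule mult_right_mono) simp
    moreover have "real (Suc k) powr Re p * real (Suc k) powr (- Re p) = 1"
      by (simp add: powr_minus)
    ultimately show ?thesis
      by (simp only: mult.assoc mult_1_right)
  next
    case False
    then have "norm (f (Suc k)) \<le> 1 * real (Suc k) powr (- Re p)"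
      using m[of "Suc k"] by simp
    also have "\<dots> \<le> C * real (Suc k) powr (- Re p)"
      using C1 by (intro mult_right_mono) auto
    finally show ?thesis .
  qed
  then show ?thesis
    using that by blast
qed

lemma summable_weighted_of_bound:
  fixes f :: "nat \<Rightarrow> 'a::real_normed_vector"
  assumes "\<And>k. norm (f k) \<le> C * real (Suc k) powr (- q)" "s + 1 < q"
  shows "summable (\<lambda>k. norm (f k) * real (Suc k) powr s)"
proof (rule summable_comparison_test')
  show "summable (\<lambda>k. C * real (Suc k) powr (s - q))"
    using assms(2) by (intro summable_mult summable_Suc_powr) simp
  fix k
  have "norm (f k) * real (Suc k) powr s
      \<le> C * real (Suc k) powr (- q) * real (Suc k) powr s"
    by (intro mult_right_mono assms(1)) simp
  also have "\<dots> = C * real (Suc k) powr (s - q)"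
    using powr_add[of "real (Suc k)" "- q" s] by simp
  finally show "norm (norm (f k) * real (Suc k) powr s) \<le> C * real (Suc k) powr (s - q)"
    by simp
qed

lemma summable_product_of_bound:
  fixes f g :: "nat \<Rightarrow> complex"
  assumes "\<And>k. norm (f k) \<le> C * real (Suc k) powr (- q)" "3 / 2 < q"
    and "\<And>k. norm (g k) \<le> D * real (Suc k) powr (- q)"
  shows "summable (\<lambda>n. (\<Sum>k\<le>n. of_nat (Suc k) * f k) * g n)"
proof (rule summable_comparison_test')
  \<comment> \<open>For the exponent \<open>1/2\<close> the condition \<open>s + 1 < q\<close> of
    the weighted test is exactly \<open>3 / 2 < q\<close>.\<close>
  note sf = summable_weighted_of_bound[OF assms(1), of "1/2"]
  note sg = summable_weighted_of_bound[OF assms(3), of "1/2"]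
  define K where "K = (\<Sum>k. norm (f k) * real (Suc k) powr (1/2))"
  show "summable (\<lambda>n. K * (norm (g n) * real (Suc n) powr (1/2)))"
    using assms(2) by (intro summable_mult sg) simp
  fix n
  \<comment> \<open>Splitting \<open>k = sqrt k * sqrt k\<close> and moving one factor onto \<open>g n\<close> avoids estimating
    \<open>\<Sum>k\<le>n. k powr (1 - q)\<close>, whose growth depends on whether \<open>q < 2\<close>.\<close>
  have "norm (\<Sum>k\<le>n. of_nat (Suc k) * f k)
      \<le> (\<Sum>k\<le>n. norm (f k) * real (Suc k) powr (1/2) * real (Suc n) powr (1/2))"
  proof (rule sum_norm_le)
    fix k assume "k \<in> {..n}"
    then have "real (Suc k) powr (1/2) \<le> real (Suc n) powr (1/2)"
      by (intro powr_mono2) auto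
    moreover have "norm (of_nat (Suc k) * f k)
        = norm (f k) * real (Suc k) powr (1/2) * real (Suc k) powr (1/2)"
      by (simp add: norm_mult powr_half_sqrt mult.assoc del: of_nat_Suc)
    ultimately show "norm (of_nat (Suc k) * f k)
        \<le> norm (f k) * real (Suc k) powr (1/2) * real (Suc n) powr (1/2)"
      by (simp add: mult_left_mono del: of_nat_Suc)
  qed
  also have "\<dots> = (\<Sum>k\<le>n. norm (f k) * real (Suc k) powr (1/2)) * real (Suc n) powr (1/2)"
    by (rule sum_distrib_right[symmetric])
  also have "\<dots> \<le> K * real (Suc n) powr (1/2)"
    unfolding K_def using assms(2) by (intro mult_right_mono sum_le_suminf sf) auto
  finally have "norm (\<Sum>k\<le>n. of_nat (Suc k) * f k) * norm (g n)
      \<le> K * real (Suc n) powr (1/2) * norm (g n)"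
    by (rule mult_right_mono) simp
  then show "norm ((\<Sum>k\<le>n. of_nat (Suc k) * f k) * g n)
      \<le> K * (norm (g n) * real (Suc n) powr (1/2))"
    by (simp add: norm_mult ac_simps del: of_nat_Suc)
qed

section \<open>Sums of zeta tails and the identity between the infinite series\<close>

text \<open>Among the tails with \<open>j \<le> n\<close>, the term \<open>z i\<close> is missing
  from those with \<open>i < j\<close>, that is, \<open>Suc n - Suc i\<close> times.\<close>

lemma sum_tails:
  fixes z :: "nat \<Rightarrow> complex"
  assumes "summable z"
  shows "(\<Sum>j\<le>n. tail z j)
       = of_nat (Suc n) * suminf z
         - (of_nat (Suc n) * (\<Sum>i<Suc n. z i) - (\<Sum>i<Suc n. of_nat (Suc i) * z i))"
  by (induction n) (simp_all add: tail_eq[OF assms] algebra_simps)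

text \<open>For \<open>Re p\<close> between 1 and 3/2 the first two series on the right can diverge:
  take \<open>p = 6/5\<close> and both sequences equal to \<open>k powr (- 5/4)\<close>. Hence the
  identity appears first as a limit of combined partial sums, where such divergences cancel, and
  then between separate series once these two converge.\<close>

theorem theorem1p2:
  fixes a b :: "nat \<Rightarrow> complex" and p :: complex and r :: nat
    and A B :: complex and L S1 S2 S3 S4 S5 S6 :: "nat \<Rightarrow> complex"
  assumes p: "Re p > 1"
    and a: "a \<in> o(\<lambda>k. of_nat k powr (- p))"
    and b: "b \<in> o(\<lambda>k. of_nat k powr (- p))"
    and r: "r \<ge> 2"
    and A: "A = lim (partial_sum a)"
    and B: "B = lim (partial_sum b)"
    and L: "L = (\<lambda>k. (A - partial_sum a k) * (B - partial_sum b k)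
                       * (zeta (of_nat r) - zeta_partial k (of_nat r)))"
    and S1: "S1 = (\<lambda>n. (\<Sum>k=1..n. of_nat k * a k) * b n)"
    and S2: "S2 = (\<lambda>n. (\<Sum>k=1..n. of_nat k * b k) * a n)"
    and S3: "S3 = (\<lambda>n. of_nat n * a n * b n)"
    and S4: "S4 = (\<lambda>n. (\<Sum>k=1..n. a k * (of_nat k * zeta_partial k (of_nat r)
                                             - zeta_partial k (of_nat r - 1))) * b n)"
    and S5: "S5 = (\<lambda>n. (\<Sum>k=1..n. b k * (of_nat k * zeta_partial k (of_nat r)
                                             - zeta_partial k (of_nat r - 1))) * a n)"
    and S6: "S6 = (\<lambda>n. a n * b n * (of_nat n * zeta_partial n (of_nat r)
                                      - zeta_partial n (of_nat r - 1)))"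
  shows "convergent (partial_sum a) \<and> convergent (partial_sum b)
    \<and> series_converges L \<and> series_converges S3 \<and> series_converges S6
    \<and> (\<lambda>N. zeta (of_nat r)
               * (partial_sum S1 N + partial_sum S2 N - partial_sum S3 N - A * B)
             - partial_sum S4 N - partial_sum S5 N + partial_sum S6 N)
        \<longlonglongrightarrow> series L
    \<and> (series_converges S1 \<and> series_converges S2 \<longrightarrow>
         series_converges S4 \<and> series_converges S5
         \<and> series L = zeta (of_nat r) * (series S1 + series S2 - series S3 - A * B)
                       - series S4 - series S5 + series S6)
    \<and> (Re p > 3 / 2 \<longrightarrow> series_converges S1 \<and> series_converges S2)"
proof -
  define x where "x = (\<lambda>k. a (Suc k))"
  define y where "y = (\<lambda>k. b (Suc k))"
  define z :: "nat \<Rightarrow> complex" where "z = (\<lambda>k. of_nat (Suc k) powr (- of_nat r))"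
  define T where "T = tail z"
  define c where "c = (\<lambda>k. \<Sum>j\<le>k. T j)"
  \<comment> \<open>Results exported from the context mention the sum of \<open>T\<close> itself;
    this equation folds it into the local \<open>c\<close>.\<close>
  have sum_T: "(\<Sum>j\<le>k. T j) = c k" for k
    by (simp add: c_def)
  define d where "d = (\<lambda>k. of_nat k * zeta_partial k (of_nat r) - zeta_partial k (of_nat r - 1))"
  \<comment> \<open>The first argument of \<open>min\<close> keeps \<open>s + 1\<close> below
    \<open>Re p\<close>; the second keeps the exponent \<open>1 - s / 2\<close> used for
    \<open>z\<close> nonnegative.\<close>
  define s where "s = min ((Re p - 1) / 2) (1 / 2)"
  have s: "0 < s" "s \<le> 1 / 2" "s + 1 < Re p"
    using p unfolding s_def by (auto simp: min_def field_simps)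

  obtain C where C: "\<And>k. norm (x k) \<le> C * real (Suc k) powr (- Re p)"
    unfolding x_def using smallo_powr_bound[OF a] by blast
  obtain D where D: "\<And>k. norm (y k) \<le> D * real (Suc k) powr (- Re p)"
    unfolding y_def using smallo_powr_bound[OF b] by blast
  have normz: "norm (z k) = real (Suc k) powr (- real r)" for k
    unfolding z_def by (subst norm_powr_real_powr) auto
  have xs: "summable (\<lambda>k. norm (x k) * real (Suc k) powr s)"
    and ys: "summable (\<lambda>k. norm (y k) * real (Suc k) powr s)"
    by (rule summable_weighted_of_bound[OF C s(3)], rule summable_weighted_of_bound[OF D s(3)])
  have nx: "summable (\<lambda>k. norm (x k))" and ny: "summable (\<lambda>k. norm (y k))"
    using summable_norm_of_weighted[OF _ xs] summable_norm_of_weighted[OF _ ys] s by auto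
  note sx = summable_norm_cancel[OF nx] and sy = summable_norm_cancel[OF ny]
  \<comment> \<open>The weight exponent must stay below 1 to allow \<open>r = 2\<close>, yet exceed
    1 when added to \<open>s\<close>; here the total is \<open>1 + s / 2\<close>.\<close>
  have zs: "summable (\<lambda>k. norm (z k) * real (Suc k) powr (1 - s / 2))"
    by (rule summable_weighted_of_bound[of _ 1 "real r"]) (use normz r s in auto)
  have nz: "summable (\<lambda>k. norm (z k))"
    by (rule summable_norm_of_weighted[OF _ zs]) (use s in auto)
  note sz = summable_norm_cancel[OF nz]
  have Tx: "summable (\<lambda>j. norm (T j) * tail (\<lambda>k. norm (x k)) j)"
    and Ty: "summable (\<lambda>j. norm (T j) * tail (\<lambda>k. norm (y k)) j)"
    unfolding T_def using s
    by (auto intro!: summable_tail_times_tail[OF _ _ _ zs xs] summable_tail_times_tail[OF _ _ _ zs ys])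

  have partial_sum_eq: "partial_sum f N = (\<Sum>k<N. f (Suc k))" for f N
    by (simp add: partial_sum_def sum.atLeast1_atMost_eq)
  have zeta_eq: "zeta (of_nat r) = suminf z"
    by (simp add: zeta_def z_def)
  have zeta_r: "zeta_partial n (of_nat r) = (\<Sum>i<n. z i)" for n
    by (simp add: zeta_partial_def z_def sum.atLeast1_atMost_eq)
  have "of_nat (Suc i) powr (- (of_nat r - 1)) = of_nat (Suc i) * z i" for i
    using powr_add[of "of_nat (Suc i)" 1 "- of_nat r :: complex"]
    by (simp add: z_def del: of_nat_Suc)
  then have zeta_r1: "zeta_partial n (of_nat r - 1) = (\<Sum>i<n. of_nat (Suc i) * z i)" for n
    unfolding zeta_partial_def by (simp add: sum.atLeast1_atMost_eq del: of_nat_Suc)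
  \<comment> \<open>The index shifts by one: \<open>c n\<close> adds \<open>Suc n\<close> tails and
    is the weight belonging to \<open>x n = a (Suc n)\<close>.\<close>
  have c_eq: "c n = of_nat (Suc n) * zeta (of_nat r) - d (Suc n)" for n
    unfolding c_def T_def d_def zeta_eq zeta_r zeta_r1 by (rule sum_tails[OF sz])

  have lim_x: "partial_sum a \<longlonglongrightarrow> suminf x" and lim_y: "partial_sum b \<longlonglongrightarrow> suminf y"
    unfolding partial_sum_eq[abs_def] using summable_LIMSEQ[OF sx] summable_LIMSEQ[OF sy]
    by (simp_all add: x_def y_def)
  have Ax: "A = suminf x" and By: "B = suminf y"
    unfolding A B using lim_x lim_y by (auto intro: limI)
  have L_eq: "L k = T k * tail x k * tail y k" for k
    unfolding L T_def Ax By zeta_eq zeta_r tail_eq[OF sx] tail_eq[OF sy] tail_eq[OF sz]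
    by (simp add: partial_sum_eq x_def y_def)
  note W = symmetric_sum_tendsto[OF nx ny Tx, unfolded sum_T]
  have Lsummable: "series_converges L"
    unfolding series_converges_def L_eq using W(1) by (subst summable_Suc_iff)
  \<comment> \<open>\<open>series L\<close> starts at index 1, so the term at 0, which is
    \<open>zeta (of_nat r) * (A * B)\<close>, is split off.\<close>
  have L_series: "series L = (\<Sum>j. T j * tail x j * tail y j) - zeta (of_nat r) * (A * B)"
    unfolding series_def L_eq using suminf_split_head[OF W(1)]
    by (simp add: T_def tail_def zeta_eq Ax By)

  have S1_eq: "S1 (Suc n) = (\<Sum>k\<le>n. of_nat (Suc k) * x k) * y n" for n
    by (simp add: S1 x_def y_def sum.atLeast1_atMost_eq lessThan_Suc_atMost del: of_nat_Suc sum.cl_ivl_Suc)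
  have S2_eq: "S2 (Suc n) = (\<Sum>k\<le>n. of_nat (Suc k) * y k) * x n" for n
    by (simp add: S2 x_def y_def sum.atLeast1_atMost_eq lessThan_Suc_atMost del: of_nat_Suc sum.cl_ivl_Suc)
  have S4_eq: "S4 (Suc n) = (\<Sum>k\<le>n. x k * d (Suc k)) * y n" for n
    by (simp add: S4 x_def y_def d_def sum.atLeast1_atMost_eq lessThan_Suc_atMost del: of_nat_Suc sum.cl_ivl_Suc)
  have S5_eq: "S5 (Suc n) = (\<Sum>k\<le>n. y k * d (Suc k)) * x n" for n
    by (simp add: S5 x_def y_def d_def sum.atLeast1_atMost_eq lessThan_Suc_atMost del: of_nat_Suc sum.cl_ivl_Suc)
  have weighted: "(\<Sum>k\<le>n. c k * u k)
      = zeta (of_nat r) * (\<Sum>k\<le>n. of_nat (Suc k) * u k) - (\<Sum>k\<le>n. u k * d (Suc k))" for u n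
    by (simp add: c_eq sum_distrib_left algebra_simps del: of_nat_Suc flip: sum_subtractf)
  have S4_S1: "S4 (Suc n) = zeta (of_nat r) * S1 (Suc n) - (\<Sum>k\<le>n. c k * x k) * y n" for n
    unfolding S4_eq S1_eq weighted by (simp add: algebra_simps)
  have S5_S2: "S5 (Suc n) = zeta (of_nat r) * S2 (Suc n) - (\<Sum>k\<le>n. c k * y k) * x n" for n
    unfolding S5_eq S2_eq weighted by (simp add: algebra_simps)
  have S6_S3: "S6 (Suc n) = zeta (of_nat r) * S3 (Suc n) - c n * x n * y n" for n
    unfolding S6 S3 c_eq d_def x_def y_def by (simp add: algebra_simps del: of_nat_Suc)

  have "zeta (of_nat r) * (partial_sum S1 N + partial_sum S2 N - partial_sum S3 N - A * B)
          - partial_sum S4 N - partial_sum S5 N + partial_sum S6 N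
      = (\<Sum>n<N. (\<Sum>k\<le>n. c k * x k) * y n + (\<Sum>k\<le>n. c k * y k) * x n - c n * x n * y n)
          - zeta (of_nat r) * (A * B)" for N
    unfolding partial_sum_eq S4_S1 S5_S2 S6_S3
    by (simp add: sum.distrib sum_subtractf algebra_simps flip: sum_distrib_left)
  then have main: "(\<lambda>N. zeta (of_nat r)
               * (partial_sum S1 N + partial_sum S2 N - partial_sum S3 N - A * B)
             - partial_sum S4 N - partial_sum S5 N + partial_sum S6 N) \<longlonglongrightarrow> series L"
    unfolding L_series using tendsto_diff[OF W(2) tendsto_const] by simp

  have C_nonneg: "0 \<le> C"
    using order_trans[OF norm_ge_zero C[of 0]] by simp
  \<comment> \<open>Since \<open>Re p > 1\<close>, the products \<open>n * a n\<close> are bounded,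
    so the third series is dominated by a multiple of the norms of \<open>b\<close>.\<close>
  have nx_le: "real (Suc n) * norm (x n) \<le> C" for n
  proof -
    have "real (Suc n) * norm (x n) \<le> real (Suc n) powr 1 * (C * real (Suc n) powr (- 1))"
    proof (rule mult_mono)
      show "norm (x n) \<le> C * real (Suc n) powr (- 1)"
        using C_nonneg p by (intro order_trans[OF C] mult_left_mono powr_mono) auto
    qed auto
    then show ?thesis
      by (simp add: powr_minus field_simps del: of_nat_Suc)
  qed
  have S3_summable: "summable (\<lambda>n. norm (S3 (Suc n)))"
  proof (rule summable_comparison_test')
    show "summable (\<lambda>n. C * norm (y n))"
      by (intro summable_mult ny)
    show "norm (norm (S3 (Suc n))) \<le> C * norm (y n)" for n
      using mult_right_mono[OF nx_le[of n], of "norm (y n)"]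
      by (simp add: S3 x_def y_def norm_mult del: of_nat_Suc)
  qed
  have S6_summable: "summable (\<lambda>n. S6 (Suc n))"
  proof (rule summable_comparison_test')
    define Z where "Z = (\<Sum>k. norm (z k))"
    show "summable (\<lambda>n. (Z + Z) * norm (S3 (Suc n)))"
      by (intro summable_mult S3_summable)
    fix n
    have Z: "(\<Sum>i<m. norm (z i)) \<le> Z" for m
      unfolding Z_def by (intro sum_le_suminf nz) auto
    have "norm (of_nat m * (\<Sum>i<m. z i)) \<le> real m * Z" for m
      unfolding norm_mult using order_trans[OF norm_sum Z[of m]] by (simp add: mult_left_mono)
    moreover have "norm (\<Sum>i<m. of_nat (Suc i) * z i) \<le> real m * Z" for m
    proof -
      have "norm (\<Sum>i<m. of_nat (Suc i) * z i) \<le> (\<Sum>i<m. real m * norm (z i))"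
        by (intro sum_norm_le) (auto simp: norm_mult intro!: mult_right_mono simp del: of_nat_Suc)
      also have "\<dots> \<le> real m * Z"
        using Z[of m] by (simp add: mult_left_mono flip: sum_distrib_left)
      finally show ?thesis .
    qed
    \<comment> \<open>Both parts of \<open>d m\<close> are at most \<open>m * Z\<close>, the factors
      \<open>Suc i\<close> in the second being at most \<open>m\<close>. The sixth series is thus
      dominated by a multiple of the third.\<close>
    ultimately have d_le: "norm (d m) \<le> real m * (Z + Z)" for m
      unfolding d_def zeta_r zeta_r1 distrib_left
      by (intro order_trans[OF norm_triangle_ineq4] add_mono) auto
    have "norm (S6 (Suc n)) = norm (a (Suc n)) * norm (b (Suc n)) * norm (d (Suc n))"
      by (simp add: S6 d_def norm_mult)
    also have "\<dots> \<le> norm (a (Suc n)) * norm (b (Suc n)) * (real (Suc n) * (Z + Z))"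
      by (intro mult_left_mono d_le) auto
    also have "\<dots> = (Z + Z) * norm (S3 (Suc n))"
      by (simp add: S3 norm_mult ac_simps del: of_nat_Suc)
    finally show "norm (S6 (Suc n)) \<le> (Z + Z) * norm (S3 (Suc n))" .
  qed
  have S3c: "series_converges S3" and S6c: "series_converges S6"
    unfolding series_converges_def using summable_norm_cancel[OF S3_summable] S6_summable by auto

  have cond: "series_converges S4 \<and> series_converges S5
         \<and> series L = zeta (of_nat r) * (series S1 + series S2 - series S3 - A * B)
                       - series S4 - series S5 + series S6"
    if S12: "series_converges S1" "series_converges S2"
  proof -
    have S4c: "series_converges S4"
      unfolding series_converges_def S4_S1 using S12(1)[unfolded series_converges_def]
      by (intro summable_diff summable_mult summable_weighted_product[OF nx ny Tx, unfolded sum_T])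
    \<comment> \<open>The same argument as for \<open>S4c\<close> with \<open>x\<close> and
      \<open>y\<close> exchanged, which calls for the majorant \<open>Ty\<close>.\<close>
    have S5c: "series_converges S5"
      unfolding series_converges_def S5_S2 using S12(2)[unfolded series_converges_def]
      by (intro summable_diff summable_mult summable_weighted_product[OF ny nx Ty, unfolded sum_T])
    have lim: "partial_sum f \<longlonglongrightarrow> series f" if "series_converges f" for f
      unfolding partial_sum_eq[abs_def] series_def
      using that unfolding series_converges_def by (rule summable_LIMSEQ)
    \<comment> \<open>With all six series convergent the limit can be taken term by term; comparison
      with \<open>main\<close> gives the identity.\<close>
    have "(\<lambda>N. zeta (of_nat r)
               * (partial_sum S1 N + partial_sum S2 N - partial_sum S3 N - A * B)
             - partial_sum S4 N - partial_sum S5 N + partial_sum S6 N)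
        \<longlonglongrightarrow> zeta (of_nat r) * (series S1 + series S2 - series S3 - A * B)
                       - series S4 - series S5 + series S6"
      by (intro tendsto_add tendsto_diff tendsto_mult tendsto_const lim S12 S3c S4c S5c S6c)
    from LIMSEQ_unique[OF main this] S4c S5c show ?thesis
      by blast
  qed
  have half: "series_converges S1 \<and> series_converges S2" if "Re p > 3 / 2"
    unfolding series_converges_def S1_eq S2_eq
    using summable_product_of_bound[OF C that D] summable_product_of_bound[OF D that C] by blast
  show ?thesis
    using lim_x lim_y Lsummable S3c S6c main cond half by (auto simp: convergent_def)
qed

end
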